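(* Let $0<q<1$, let ${\bf u}$ be a quasi-definite linear functional on polynomials with monic orthogonal polynomial sequence $(p_n)_{n\ge 0}$, let $\alpha,N\in\mathbb R$, and suppose that the sequence $(s_n^{(\alpha)}(N;x))_{n\ge 0}$ of monic polynomials orthogonal with respect to $$\langle f,g\rangle_S=\langle {\bf u},fg\rangle+N(\mathscr D_qf)(\alpha)(\mathscr D_qg)(\alpha)$$ exists. Then for every $n\ge 1$ $$s_n^{(\alpha)}(N;x)=p_n(x)-\frac{N(\mathscr D_qp_n)(\alpha)}{1+N\mathscr K_{q,n}^{(1,1)}(\alpha,\alpha)}\,\mathscr K_{q,n}^{(0,1)}(x,\alpha).$$
   Context: The $q$-derivative is $(\mathscr D_qf)(x)=\frac{f(qx)-f(x)}{(q-1)x}$ for $x\neq0$ and $(\mathscr D_qf)(0)=f'(0)$. A linear functional ${\bf u}$ on complex polynomials is quasi-definite if all principal Hankel matrices of its moments are non-singular; equivalently there is a unique sequence of monic polynomials $p_n$, $\deg p_n=n$, with $\langle{\bf u},p_np_m\rangle=\langle{\bf u},p_n^2\rangle\delta_{n,m}$ and $\langle{\bf u},p_n^2\rangle\ne0$. The monic polynomials $s_n^{(\alpha)}(N;x)$ satisfy $\deg s_n^{(\alpha)}=n$, $\langle s_n^{(\alpha)},s_m^{(\alpha)}\rangle_S=0$ for $n\neq m$ and $\langle s_n^{(\alpha)},s_n^{(\alpha)}\rangle_S\ne0$. The kernels are $$\mathscr K_{q,n}^{(i,j)}(x,y)=\sum_{k=0}^{n-1}\frac{(\mathscr D_q^ip_k)(x)(\mathscr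 D_q^jp_k)(y)}{\langle{\bf u},p_k^2\rangle}.$$ *)

theory Defs
  imports "HOL-Analysis.Derivative" "Jordan_Normal_Form.Determinant"
begin

definition qderiv :: "real \<Rightarrow> (complex \<Rightarrow> complex) \<Rightarrow> complex \<Rightarrow> complex" where
  "qderiv q f x =
     (if x = 0 then deriv f 0
      else (f (of_real q * x) - f x) / ((of_real q - 1) * x))"

definition linear_functional :: "(complex poly \<Rightarrow> complex) \<Rightarrow> bool" where
  "linear_functional u \<longleftrightarrow> Vector_Spaces.linear smult (*) u"

definition hankel_mat :: "(complex poly \<Rightarrow> complex) \<Rightarrow> nat \<Rightarrow> complex mat" where
  "hankel_mat u n = mat n n (\<lambda>(i, j). u (monom 1 (i + j)))"

text \<open>As usual for moment functionals, the principal Hankel matrices are the leading ones,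
  indexed by \<open>0, \<dots>, n\<close> for \<open>n \<ge> 0\<close>.\<close>

definition quasi_definite :: "(complex poly \<Rightarrow> complex) \<Rightarrow> bool" where
  "quasi_definite u \<longleftrightarrow> (\<forall>n. Determinant.det (hankel_mat u (Suc n)) \<noteq> 0)"

definition monic_orthogonal ::
  "(complex poly \<Rightarrow> complex poly \<Rightarrow> complex) \<Rightarrow> (nat \<Rightarrow> complex poly) \<Rightarrow> bool" where
  "monic_orthogonal B p \<longleftrightarrow>
     (\<forall>n. degree (p n) = n \<and> lead_coeff (p n) = 1) \<and>
     (\<forall>n m. n \<noteq> m \<longrightarrow> B (p n) (p m) = 0) \<and>
     (\<forall>n. B (p n) (p n) \<noteq> 0)"

definition sobolev_form ::
  "real \<Rightarrow> (complex poly \<Rightarrow> complex) \<Rightarrow> real \<Rightarrow> real \<Rightarrow> complex poly \<Rightarrow> complex poly \<Rightarrow> complex" where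
  "sobolev_form q u \<alpha> N f g =
     u (f * g) + of_real N * qderiv q (poly f) (of_real \<alpha>) * qderiv q (poly g) (of_real \<alpha>)"

definition qkernel ::
  "real \<Rightarrow> (complex poly \<Rightarrow> complex) \<Rightarrow> (nat \<Rightarrow> complex poly) \<Rightarrow> nat \<Rightarrow> nat \<Rightarrow> nat
     \<Rightarrow> complex \<Rightarrow> complex \<Rightarrow> complex" where
  "qkernel q u p n i j x y =
     (\<Sum>k<n. (qderiv q ^^ i) (poly (p k)) x * (qderiv q ^^ j) (poly (p k)) y / u ((p k)\<^sup>2))"

end

theory Submission
  imports Defs
begin

text \<open>The Sobolev form is a rank-one perturbation \<open>S f g = B f g + M * L f * L g\<close> of the
  bilinear form \<open>B f g = u (f * g)\<close>, where \<open>L f\<close> is the value of the \<open>q\<close>-derivative of \<open>f\<close> at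
  \<open>\<alpha>\<close>, a linear functional of \<open>f\<close>, and \<open>M = N\<close>.

  The difference \<open>s n - p n\<close> has degree below \<open>n\<close>, so it is a combination of the \<open>p k\<close> with
  \<open>k < n\<close>, with Fourier coefficients \<open>B (s n) (p k) / B (p k) (p k)\<close>. Since \<open>s n\<close> is
  \<open>S\<close>-orthogonal to all polynomials of lower degree, \<open>B (s n) (p k) = - M * L (s n) * L (p k)\<close>.
  Hence \<open>s n = p n - M * L (s n) * G\<close>, where \<open>G = (\<Sum>k<n. L (p k) * p k / B (p k) (p k))\<close> is the
  polynomial that represents \<open>L\<close> with respect to \<open>B\<close> in degrees below \<open>n\<close>, that is, the kernel
  with one variable differentiated. Applying \<open>L\<close> gives \<open>L (s n) * (1 + M * L G) = L (p n)\<close>, and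
  \<open>L G\<close> is the kernel with both variables differentiated.

  The remaining point is \<open>1 + M * L G \<noteq> 0\<close>. It follows from the existence of \<open>s\<close>, which makes
  \<open>S\<close> nondegenerate in degrees below \<open>n\<close>: one has \<open>S G f = (1 + M * L G) * L f\<close> there, so
  \<open>1 + M * L G = 0\<close> would force \<open>G = 0\<close> and then \<open>1 = 0\<close>. The argument is carried out abstractly in
  \<open>rank_one_connection\<close>, from the expansion \<open>orthogonal_expansion\<close>.\<close>

section \<open>Expansions in monic orthogonal polynomials\<close>

text \<open>The bound \<open>degree f < n\<close> is expressed by vanishing coefficients, so that the zero polynomial
  and \<open>n = 0\<close> are covered.\<close>

lemma monic_sequence_spans:
  fixes p :: "nat \<Rightarrow> 'a::comm_ring_1 poly"
  assumes monic: "\<And>n. degree (p n) = n" "\<And>n. lead_coeff (p n) = 1"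
    and "\<And>k. k \<ge> n \<Longrightarrow> coeff f k = 0"
  shows "\<exists>c. f = (\<Sum>k<n. smult (c k) (p k))"
  using assms(3)
proof (induction n arbitrary: f)
  case 0
  then show ?case by (auto simp: poly_eq_iff)
next
  case (Suc n)
  define g where "g = f - smult (coeff f n) (p n)"
  have lead: "coeff (p n) n = 1"
    using monic[of n] by simp
  have "coeff g k = 0" if "k \<ge> n" for k
  proof (cases "k = n")
    case True
    then show ?thesis using lead by (simp add: g_def)
  next
    case False
    with that have "coeff (p n) k = 0"
      using monic(1)[of n] by (intro coeff_eq_0) simp
    then show ?thesis using False that Suc.prems[of k] by (simp add: g_def)
  qed
  then obtain c where c: "g = (\<Sum>k<n. smult (c k) (p k))"
    using Suc.IH by blast
  have "f = (\<Sum>k<Suc n. smult ((c(n := coeff f n)) k) (p k))"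
    using c by (simp add: g_def algebra_simps)
  then show ?case by blast
qed

lemma monic_orthogonal_coeff:
  assumes "monic_orthogonal B p" "k \<ge> n"
  shows "coeff (p n) k = (if k = n then 1 else 0)"
proof -
  have deg: "degree (p n) = n" and lead: "lead_coeff (p n) = 1"
    using assms(1) unfolding monic_orthogonal_def by blast+
  show ?thesis
  proof (cases "k = n")
    case True
    then show ?thesis using lead unfolding deg by simp
  next
    case False
    then show ?thesis using deg assms(2) by (simp add: coeff_eq_0)
  qed
qed

lemma linear_sum_smult:
  fixes l :: "'a::field poly \<Rightarrow> 'a"
  assumes "Vector_Spaces.linear smult (*) l"
  shows "l (\<Sum>k\<in>A. smult (c k) (p k)) = (\<Sum>k\<in>A. c k * l (p k))"
proof -
  interpret Vector_Spaces.linear smult "(*)" l by fact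
  show ?thesis by (simp add: sum scale)
qed

lemma orthogonal_expansion:
  assumes lin: "\<And>g. Vector_Spaces.linear smult (*) (\<lambda>f. B f g)"
    and orth: "monic_orthogonal B p"
    and deg: "\<And>k. k \<ge> n \<Longrightarrow> coeff f k = 0"
  shows "f = (\<Sum>k<n. smult (B f (p k) / B (p k) (p k)) (p k))"
proof -
  obtain c where c: "f = (\<Sum>k<n. smult (c k) (p k))"
    using monic_sequence_spans[of p n f, OF _ _ deg] orth
    unfolding monic_orthogonal_def by blast
  have "B f (p j) / B (p j) (p j) = c j" if "j < n" for j
  proof -
    have "B f (p j) = (\<Sum>k<n. c k * B (p k) (p j))"
      unfolding c by (rule linear_sum_smult[OF lin])
    also have "\<dots> = (\<Sum>k<n. if k = j then c j * B (p j) (p j) else 0)"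
      using orth by (intro sum.cong) (auto simp: monic_orthogonal_def)
    also have "\<dots> = c j * B (p j) (p j)"
      using that by simp
    finally show ?thesis using orth by (simp add: monic_orthogonal_def)
  qed
  then have "(\<Sum>k<n. smult (c k) (p k)) = (\<Sum>k<n. smult (B f (p k) / B (p k) (p k)) (p k))"
    by (intro sum.cong) auto
  with c show ?thesis by (rule trans)
qed

lemma orthogonal_to_lower_degree:
  assumes lin: "\<And>g. Vector_Spaces.linear smult (*) (\<lambda>f. B f g)"
    and orth: "monic_orthogonal B p"
    and deg: "\<And>k. k \<ge> n \<Longrightarrow> coeff f k = 0"
  shows "B f (p n) = 0"
proof -
  let ?c = "\<lambda>k. B f (p k) / B (p k) (p k)"
  have "B f (p n) = B (\<Sum>k<n. smult (?c k) (p k)) (p n)"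
    using orthogonal_expansion[OF lin orth deg] by simp
  also have "\<dots> = (\<Sum>k<n. ?c k * B (p k) (p n))"
    by (rule linear_sum_smult[OF lin])
  also have "\<dots> = 0"
    using orth by (intro sum.neutral) (auto simp: monic_orthogonal_def)
  finally show ?thesis .
qed

section \<open>Rank-one perturbations\<close>

lemma linear_rank_one_perturbation:
  fixes l L :: "'a::field poly \<Rightarrow> 'a"
  assumes "Vector_Spaces.linear smult (*) l" "Vector_Spaces.linear smult (*) L"
  shows "Vector_Spaces.linear smult (*) (\<lambda>f. l f + M * L f * c)"
proof -
  interpret l: Vector_Spaces.linear smult "(*)" l by fact
  interpret L: Vector_Spaces.linear smult "(*)" L by fact
  show ?thesis
    by unfold_locales (auto simp: l.add l.scale L.add L.scale algebra_simps)
qed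

text \<open>The polynomial \<open>G n\<close> is the Riesz representer of \<open>L\<close> for \<open>B\<close> in degrees below \<open>n\<close>. Hence the
  perturbed form pairs it with such polynomials by a multiple of \<open>L\<close>, with factor
  \<open>1 + M * L (G n)\<close>, and this factor cannot vanish when the perturbed form has an orthogonal
  sequence.\<close>

lemma rank_one_connection:
  fixes M :: complex
  assumes lin: "\<And>g. Vector_Spaces.linear smult (*) (\<lambda>f. B f g)"
    and sym: "\<And>f g. B f g = B g f"
    and L: "Vector_Spaces.linear smult (*) L"
    and p: "monic_orthogonal B p"
    and s: "monic_orthogonal (\<lambda>f g. B f g + M * L f * L g) s"
  defines "G \<equiv> \<lambda>n. \<Sum>k<n. smult (L (p k) / B (p k) (p k)) (p k)"
  shows "1 + M * L (G n) \<noteq> 0"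
    and "s n = p n - smult (M * L (p n) / (1 + M * L (G n))) (G n)"
proof -
  define S where "S = (\<lambda>f g. B f g + M * L f * L g)"
  have s: "monic_orthogonal S s"
    using s by (simp add: S_def)
  have linS: "Vector_Spaces.linear smult (*) (\<lambda>f. S f g)" for g
    unfolding S_def by (rule linear_rank_one_perturbation[OF lin L])
  have symS: "S f g = S g f" for f g
    by (simp add: S_def sym[of f g])
  interpret L: Vector_Spaces.linear smult "(*)" L by fact
  have coeff_p: "coeff (p m) k = (if k = m then 1 else 0)"
    and coeff_s: "coeff (s m) k = (if k = m then 1 else 0)" if "k \<ge> m" for m k
    using monic_orthogonal_coeff[OF p that] monic_orthogonal_coeff[OF s that] by simp_all
  have G_deg: "coeff (G n) k = 0" if "k \<ge> n" for k
    using that by (auto simp: G_def coeff_sum coeff_p intro!: sum.neutral)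

  have represents: "B (G n) f = L f" if deg: "\<And>k. k \<ge> n \<Longrightarrow> coeff f k = 0" for f
  proof -
    have "B (G n) f = (\<Sum>k<n. L (p k) / B (p k) (p k) * B (p k) f)"
      unfolding G_def by (rule linear_sum_smult[OF lin])
    also have "\<dots> = (\<Sum>k<n. B f (p k) / B (p k) (p k) * L (p k))"
      by (simp add: sym[of f] mult.commute)
    also have "\<dots> = L (\<Sum>k<n. smult (B f (p k) / B (p k) (p k)) (p k))"
      by (rule linear_sum_smult[OF L, symmetric])
    also have "\<dots> = L f"
      using orthogonal_expansion[OF lin p deg] by simp
    finally show ?thesis .
  qed

  show nz: "1 + M * L (G n) \<noteq> 0"
  proof
    assume zero: "1 + M * L (G n) = 0"
    have "S (G n) (s k) = 0" if "k < n" for k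
    proof -
      have "B (G n) (s k) = L (s k)"
        using that by (intro represents) (simp add: coeff_s)
      then have "S (G n) (s k) = (1 + M * L (G n)) * L (s k)"
        by (simp add: S_def algebra_simps)
      then show ?thesis using zero by simp
    qed
    then have "G n = 0"
      by (subst orthogonal_expansion[OF linS s G_deg]) (auto intro!: sum.neutral)
    then show False using zero by (simp add: L.zero)
  qed

  define d where "d = s n - p n"
  have d_deg: "coeff d k = 0" if "k \<ge> n" for k
    using that by (simp add: d_def coeff_p coeff_s)
  have fourier: "B d (p k) = - M * L (s n) * L (p k)" if "k < n" for k
  proof -
    interpret Bk: Vector_Spaces.linear smult "(*)" "\<lambda>f. B f (p k)" by (rule lin)
    have "S (p k) (s n) = 0"
      using that by (intro orthogonal_to_lower_degree[OF linS s]) (simp add: coeff_p)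
    then have "B (s n) (p k) = - M * L (s n) * L (p k)"
      unfolding symS[of "p k"] by (simp add: S_def eq_neg_iff_add_eq_0)
    moreover have "B (p n) (p k) = 0"
      using p that by (simp add: monic_orthogonal_def)
    ultimately show ?thesis by (simp add: d_def Bk.diff)
  qed
  have "d = (\<Sum>k<n. smult (B d (p k) / B (p k) (p k)) (p k))"
    using orthogonal_expansion[OF lin p d_deg] .
  also have "\<dots> = smult (- M * L (s n)) (G n)"
    by (simp add: fourier G_def poly_eq_iff coeff_sum sum_distrib_left sum_negf mult.assoc)
  finally have s_eq: "s n = p n - smult (M * L (s n)) (G n)"
    by (simp add: d_def algebra_simps)
  have "L (s n) = L (p n) - M * L (s n) * L (G n)"
    by (subst s_eq) (simp add: L.diff L.scale)
  then have "L (s n) * (1 + M * L (G n)) = L (p n)"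
    by (simp add: algebra_simps)
  then have "L (s n) = L (p n) / (1 + M * L (G n))"
    using nz by (simp add: eq_divide_eq)
  then show "s n = p n - smult (M * L (p n) / (1 + M * L (G n))) (G n)"
    by (subst s_eq) simp
qed

section \<open>The Sobolev form of the \<open>q\<close>-derivative\<close>

lemma linear_qderiv: "Vector_Spaces.linear smult (*) (\<lambda>f. qderiv q (poly f) x)"
proof -
  have deriv: "deriv (poly f) 0 = poly (pderiv f) 0" for f :: "complex poly"
    by (intro DERIV_imp_deriv poly_DERIV)
  show ?thesis
    by unfold_locales
      (auto simp: qderiv_def deriv pderiv_add pderiv_smult algebra_simps add_divide_distrib
        diff_divide_distrib smult_add_left smult_add_right)
qed

lemma linear_moment_form:
  assumes "linear_functional u"
  shows "Vector_Spaces.linear smult (*) (\<lambda>f. u (f * g))"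
proof -
  interpret Vector_Spaces.linear smult "(*)" u
    using assms by (simp add: linear_functional_def)
  show ?thesis
    by unfold_locales (simp_all add: distrib_right add scale[symmetric] algebra_simps)
qed

theorem mainTheorem1:
  fixes q \<alpha> N :: real
    and u :: "complex poly \<Rightarrow> complex"
    and p s :: "nat \<Rightarrow> complex poly"
  assumes q: "0 < q" "q < 1"
    and u_linear: "linear_functional u"
    and u_quasi_definite: "quasi_definite u"
    and p_orthogonal: "monic_orthogonal (\<lambda>f g. u (f * g)) p"
    and s_orthogonal: "monic_orthogonal (sobolev_form q u \<alpha> N) s"
  shows "\<forall>n\<ge>1.
    1 + of_real N * qkernel q u p n 1 1 (of_real \<alpha>) (of_real \<alpha>) \<noteq> 0 \<and>
    (\<forall>x. poly (s n) x =
      poly (p n) x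
      - of_real N * qderiv q (poly (p n)) (of_real \<alpha>)
          / (1 + of_real N * qkernel q u p n 1 1 (of_real \<alpha>) (of_real \<alpha>))
          * qkernel q u p n 0 1 x (of_real \<alpha>))"
proof (intro allI impI)
  fix n :: nat
  define a :: complex where "a = of_real \<alpha>"
  define M :: complex where "M = of_real N"
  define L where "L = (\<lambda>f. qderiv q (poly f) a)"
  define G where "G = (\<Sum>k<n. smult (L (p k) / u (p k * p k)) (p k))"
  have L: "Vector_Spaces.linear smult (*) L"
    unfolding L_def by (rule linear_qderiv)
  have s: "monic_orthogonal (\<lambda>f g. u (f * g) + M * L f * L g) s"
    using s_orthogonal by (simp add: sobolev_form_def[abs_def] M_def L_def a_def)
  have sym: "u (f * g) = u (g * f)" for f g
    by (simp add: mult.commute)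
  note conn = rank_one_connection[OF linear_moment_form[OF u_linear] sym L p_orthogonal s,
      of n, folded G_def]
  have "L G = (\<Sum>k<n. L (p k) / u (p k * p k) * L (p k))"
    unfolding G_def by (rule linear_sum_smult[OF L])
  then have K11: "qkernel q u p n 1 1 a a = L G"
    by (simp add: qkernel_def L_def power2_eq_square)
  have K01: "qkernel q u p n 0 1 x a = poly G x" for x
    by (simp add: qkernel_def G_def L_def poly_sum power2_eq_square mult.commute)
  have "poly (s n) x = poly (p n) x - M * L (p n) / (1 + M * L G) * poly G x" for x
    by (subst conn(2)) simp
  with conn(1) show "1 + of_real N * qkernel q u p n 1 1 (of_real \<alpha>) (of_real \<alpha>) \<noteq> 0 \<and>
    (\<forall>x. poly (s n) x =
      poly (p n) x
      - of_real N * qderiv q (poly (p n)) (of_real \<alpha>)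
          / (1 + of_real N * qkernel q u p n 1 1 (of_real \<alpha>) (of_real \<alpha>))
          * qkernel q u p n 0 1 x (of_real \<alpha>))"
    unfolding a_def[symmetric] M_def[symmetric] K11 K01 by (simp add: L_def)
qed

end
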